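(* Let $E$ and $F$ be Riesz algebras and let $T:E\to F$ be a positive quasi $\mathbb{m}_l\mathbb{o}$-Levi operator. Then each operator $S:E\to F$ satisfying $0\le S\le T$ is also quasi $\mathbb{m}_l\mathbb{o}$-Levi. The same holds with "quasi $\mathbb{m}_l\mathbb{o}$-Levi" replaced throughout by "quasi $\mathbb{m}_r\mathbb{o}$-Levi", and with "quasi $\mathbb{m}_l\mathbb{o}$-Levi" replaced throughout by "quasi $\mathbb{mo}$-Levi".
   Context: All vector spaces are real and all operators are linear. A Riesz algebra is a Riesz space $E$ that is an associative algebra with $x\cdot y\in E_+$ whenever $x,y\in E_+$. Order convergence: a net $x_\alpha\xrightarrow{\mathbb{o}}x$ in a Riesz space if there is a net $y_\beta\downarrow 0$ such that for every $\beta$ there is $\alpha_\beta$ with $|x_\alpha-x|\le y_\beta$ for all $\alpha\ge\alpha_\beta$. In a Riesz algebra $F$: $x_\alpha\xrightarrow{\mathbb{m}_l\mathbb{o}}x$ means $u\cdot|x_\alpha-x|\xrightarrow{\mathbb{o}}0$ for all $u\in F_+$; $x_\alpha\xrightarrow{\mathbb{m}_r\mathbb{o}}x$ means $|x_\alpha-x|\cdot u\xrightarrow{\mathbb{o}}0$ for all $u\in F_+$; $x_\alpha\xrightarrow{\mathbb{m}\mathbb{o}}x$ means both hold. For $\mathbb{c}\in\{\mathbb{mo},\mathbb{m}_l\mathbb{o},\mathbb{m}_r\mathbb{o}\}$, a net $(y_\alpha)_{\alpha\in A}$ in $F$ is $\mathbb{c}$-Cauchy if the net $(y_{\alpha_1}-y_{\alpha_2})_{(\alpha_1,\alpha_2)\in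 A\times A}$ $\mathbb{c}$-converges to $0$. A subset $A$ of a Riesz algebra $E$ is $\mathbb{m}_l\mathbb{o}$-bounded if $u\cdot A$ is order bounded for each $u\in E_+$; $\mathbb{m}_r\mathbb{o}$-bounded if $A\cdot u$ is order bounded for each $u\in E_+$; $\mathbb{mo}$-bounded if both. For $\mathbb{c}\in\{\mathbb{mo},\mathbb{m}_l\mathbb{o},\mathbb{m}_r\mathbb{o}\}$, an operator $T:E\to F$ is quasi $\mathbb{c}$-Levi if for every $\mathbb{c}$-bounded increasing net $x_\alpha$ in $E_+$ the net $Tx_\alpha$ is $\mathbb{c}$-Cauchy in $F$. $R\le Q$ for operators means $Q-R$ is positive. *)

theory Defs
  imports Complex_Main "HOL-Library.Lattice_Algebras"
begin

(* real_algebra is associative and need not have a unit. In lattice_ring, multiplication by a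
   nonnegative element is monotone (equivalently, products of nonnegative elements are
   nonnegative) and the absolute value satisfies abs x = sup x (- x). *)
class riesz_algebra = lattice_ring + real_algebra + ordered_real_vector

(* A net is a family x indexed by a set A that is directed by a preorder le. *)
definition directed_set :: "'i set \<Rightarrow> ('i \<Rightarrow> 'i \<Rightarrow> bool) \<Rightarrow> bool" where
  "directed_set A le \<longleftrightarrow> A \<noteq> {} \<and> reflp_on A le \<and> transp_on A le \<and>
     (\<forall>a\<in>A. \<forall>b\<in>A. \<exists>c\<in>A. le a c \<and> le b c)"

definition increasing_net ::
  "'i set \<Rightarrow> ('i \<Rightarrow> 'i \<Rightarrow> bool) \<Rightarrow> ('i \<Rightarrow> 'a::order) \<Rightarrow> bool" where
  "increasing_net A le x \<longleftrightarrow> directed_set A le \<and> monotone_on A le (\<le>) x"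

definition decreasing_to_zero ::
  "'i set \<Rightarrow> ('i \<Rightarrow> 'i \<Rightarrow> bool) \<Rightarrow> ('i \<Rightarrow> 'a::{order,zero}) \<Rightarrow> bool" where
  "decreasing_to_zero B le y \<longleftrightarrow> directed_set B le \<and> monotone_on B le (\<ge>) y \<and>
     (\<forall>b\<in>B. 0 \<le> y b) \<and> (\<forall>z. (\<forall>b\<in>B. z \<le> y b) \<longrightarrow> z \<le> 0)"

(* HOL cannot quantify over the index type of the dominating net y inside a definition.
   Its index set is taken inside the space itself; o_convergesI below shows that
   dominating nets with any other index type give the same notion. *)
definition o_converges ::
  "'i set \<Rightarrow> ('i \<Rightarrow> 'i \<Rightarrow> bool) \<Rightarrow> ('i \<Rightarrow> 'a) \<Rightarrow> 'a::lattice_ab_group_add_abs \<Rightarrow> bool" where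
  "o_converges A le x l \<longleftrightarrow>
     (\<exists>(B::'a set) leB (y::'a \<Rightarrow> 'a). decreasing_to_zero B leB y \<and>
        (\<forall>b\<in>B. \<exists>a\<in>A. \<forall>a'\<in>A. le a a' \<longrightarrow> \<bar>x a' - l\<bar> \<le> y b))"

lemma o_convergesI:
  fixes B :: "'j set" and y :: "'j \<Rightarrow> 'a::lattice_ab_group_add_abs"
  assumes y: "decreasing_to_zero B leB y"
    and dom: "\<And>b. b \<in> B \<Longrightarrow> \<exists>a\<in>A. \<forall>a'\<in>A. le a a' \<longrightarrow> \<bar>x a' - l\<bar> \<le> y b"
  shows "o_converges A le x l"
proof -
  have "decreasing_to_zero (y ` B) (\<ge>) (\<lambda>v. v)"
    unfolding decreasing_to_zero_def directed_set_def
  proof (intro conjI)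
    show "\<forall>a\<in>y ` B. \<forall>b\<in>y ` B. \<exists>c\<in>y ` B. c \<le> a \<and> c \<le> b"
    proof (intro ballI)
      fix a b assume "a \<in> y ` B" "b \<in> y ` B"
      then obtain i j where ij: "i \<in> B" "j \<in> B" "a = y i" "b = y j" by blast
      then obtain k where "k \<in> B" "leB i k" "leB j k"
        using y unfolding decreasing_to_zero_def directed_set_def by meson
      then show "\<exists>c\<in>y ` B. c \<le> a \<and> c \<le> b"
        using y ij unfolding decreasing_to_zero_def monotone_on_def by blast
    qed
    show "transp_on (y ` B) (\<ge>)"
      by (rule transp_onI) (rule order_trans)
  qed (use y in \<open>simp_all add: decreasing_to_zero_def directed_set_def reflp_on_def monotone_on_def\<close>)
  moreover have "\<forall>b\<in>y ` B. \<exists>a\<in>A. \<forall>a'\<in>A. le a a' \<longrightarrow> \<bar>x a' - l\<bar> \<le> b"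
    using dom by blast
  ultimately show ?thesis
    unfolding o_converges_def by blast
qed

definition mlo_converges ::
  "'i set \<Rightarrow> ('i \<Rightarrow> 'i \<Rightarrow> bool) \<Rightarrow> ('i \<Rightarrow> 'a) \<Rightarrow> 'a::riesz_algebra \<Rightarrow> bool" where
  "mlo_converges A le x l \<longleftrightarrow> (\<forall>u\<ge>0. o_converges A le (\<lambda>a. u * \<bar>x a - l\<bar>) 0)"

definition mro_converges ::
  "'i set \<Rightarrow> ('i \<Rightarrow> 'i \<Rightarrow> bool) \<Rightarrow> ('i \<Rightarrow> 'a) \<Rightarrow> 'a::riesz_algebra \<Rightarrow> bool" where
  "mro_converges A le x l \<longleftrightarrow> (\<forall>u\<ge>0. o_converges A le (\<lambda>a. \<bar>x a - l\<bar> * u) 0)"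

definition mo_converges ::
  "'i set \<Rightarrow> ('i \<Rightarrow> 'i \<Rightarrow> bool) \<Rightarrow> ('i \<Rightarrow> 'a) \<Rightarrow> 'a::riesz_algebra \<Rightarrow> bool" where
  "mo_converges A le x l \<longleftrightarrow> mlo_converges A le x l \<and> mro_converges A le x l"

definition prod_le :: "('i \<Rightarrow> 'i \<Rightarrow> bool) \<Rightarrow> 'i \<times> 'i \<Rightarrow> 'i \<times> 'i \<Rightarrow> bool" where
  "prod_le le p q \<longleftrightarrow> le (fst p) (fst q) \<and> le (snd p) (snd q)"

definition mlo_cauchy ::
  "'i set \<Rightarrow> ('i \<Rightarrow> 'i \<Rightarrow> bool) \<Rightarrow> ('i \<Rightarrow> 'a::riesz_algebra) \<Rightarrow> bool" where
  "mlo_cauchy A le y \<longleftrightarrow> mlo_converges (A \<times> A) (prod_le le) (\<lambda>(a, b). y a - y b) 0"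

definition mro_cauchy ::
  "'i set \<Rightarrow> ('i \<Rightarrow> 'i \<Rightarrow> bool) \<Rightarrow> ('i \<Rightarrow> 'a::riesz_algebra) \<Rightarrow> bool" where
  "mro_cauchy A le y \<longleftrightarrow> mro_converges (A \<times> A) (prod_le le) (\<lambda>(a, b). y a - y b) 0"

definition mo_cauchy ::
  "'i set \<Rightarrow> ('i \<Rightarrow> 'i \<Rightarrow> bool) \<Rightarrow> ('i \<Rightarrow> 'a::riesz_algebra) \<Rightarrow> bool" where
  "mo_cauchy A le y \<longleftrightarrow> mo_converges (A \<times> A) (prod_le le) (\<lambda>(a, b). y a - y b) 0"

definition order_bounded :: "'a::order set \<Rightarrow> bool" where
  "order_bounded X \<longleftrightarrow> (\<exists>a b. X \<subseteq> {a..b})"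

definition mlo_bounded :: "'a::riesz_algebra set \<Rightarrow> bool" where
  "mlo_bounded X \<longleftrightarrow> (\<forall>u\<ge>0. order_bounded ((\<lambda>x. u * x) ` X))"

definition mro_bounded :: "'a::riesz_algebra set \<Rightarrow> bool" where
  "mro_bounded X \<longleftrightarrow> (\<forall>u\<ge>0. order_bounded ((\<lambda>x. x * u) ` X))"

definition mo_bounded :: "'a::riesz_algebra set \<Rightarrow> bool" where
  "mo_bounded X \<longleftrightarrow> mlo_bounded X \<and> mro_bounded X"

(* The nets tested by the Levi properties again have their index sets inside the domain type,
   with an arbitrary directed preorder. The lemmas quasi_mlo_levi_any_index,
   quasi_mro_levi_any_index and quasi_mo_levi_any_index below show that each property then
   holds for nets with any index type. *)
definition quasi_mlo_levi :: "('e::riesz_algebra \<Rightarrow> 'f::riesz_algebra) \<Rightarrow> bool" where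
  "quasi_mlo_levi T \<longleftrightarrow>
     (\<forall>(A::'e set) le (x::'e \<Rightarrow> 'e). increasing_net A le x \<and> (\<forall>a\<in>A. 0 \<le> x a) \<and>
        mlo_bounded (x ` A) \<longrightarrow> mlo_cauchy A le (\<lambda>a. T (x a)))"

definition quasi_mro_levi :: "('e::riesz_algebra \<Rightarrow> 'f::riesz_algebra) \<Rightarrow> bool" where
  "quasi_mro_levi T \<longleftrightarrow>
     (\<forall>(A::'e set) le (x::'e \<Rightarrow> 'e). increasing_net A le x \<and> (\<forall>a\<in>A. 0 \<le> x a) \<and>
        mro_bounded (x ` A) \<longrightarrow> mro_cauchy A le (\<lambda>a. T (x a)))"

definition quasi_mo_levi :: "('e::riesz_algebra \<Rightarrow> 'f::riesz_algebra) \<Rightarrow> bool" where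
  "quasi_mo_levi T \<longleftrightarrow>
     (\<forall>(A::'e set) le (x::'e \<Rightarrow> 'e). increasing_net A le x \<and> (\<forall>a\<in>A. 0 \<le> x a) \<and>
        mo_bounded (x ` A) \<longrightarrow> mo_cauchy A le (\<lambda>a. T (x a)))"

lemma increasing_net_image:
  assumes "increasing_net A le x"
  shows "increasing_net (x ` A) (\<le>) (\<lambda>v. v)"
  unfolding increasing_net_def directed_set_def
proof (intro conjI)
  show "\<forall>a\<in>x ` A. \<forall>b\<in>x ` A. \<exists>c\<in>x ` A. a \<le> c \<and> b \<le> c"
  proof (intro ballI)
    fix a b assume "a \<in> x ` A" "b \<in> x ` A"
    then obtain i j where ij: "i \<in> A" "j \<in> A" "a = x i" "b = x j" by blast
    then obtain k where "k \<in> A" "le i k" "le j k"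
      using assms unfolding increasing_net_def directed_set_def by meson
    then have "x k \<in> x ` A" "a \<le> x k" "b \<le> x k"
      using assms ij unfolding increasing_net_def by (auto dest: monotone_onD)
    then show "\<exists>c\<in>x ` A. a \<le> c \<and> b \<le> c"
      by blast
  qed
next
  show "x ` A \<noteq> {}"
    using assms by (simp add: increasing_net_def directed_set_def)
  show "transp_on (x ` A) (\<le>)"
    by (rule transp_onI) (rule order_trans)
qed (simp_all add: reflp_on_def monotone_on_def)

lemma o_converges_pair_image:
  fixes l :: "'a::lattice_ab_group_add_abs"
  assumes mono: "monotone_on A le (\<le>) x"
    and conv: "o_converges (x ` A \<times> x ` A) (prod_le (\<le>)) f l"
  shows "o_converges (A \<times> A) (prod_le le) (\<lambda>p. f (x (fst p), x (snd p))) l"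
proof -
  obtain B :: "'a set" and leB and y :: "'a \<Rightarrow> 'a" where y: "decreasing_to_zero B leB y"
    and dom: "\<forall>b\<in>B. \<exists>p\<in>x ` A \<times> x ` A. \<forall>q\<in>x ` A \<times> x ` A.
                prod_le (\<le>) p q \<longrightarrow> \<bar>f q - l\<bar> \<le> y b"
    using conv unfolding o_converges_def by blast
  show ?thesis
  proof (rule o_convergesI[OF y])
    fix b assume "b \<in> B"
    then obtain a1 a2 where a: "a1 \<in> A" "a2 \<in> A"
      and *: "\<forall>q\<in>x ` A \<times> x ` A. prod_le (\<le>) (x a1, x a2) q \<longrightarrow> \<bar>f q - l\<bar> \<le> y b"
      using dom by blast
    have "\<bar>f (x (fst q), x (snd q)) - l\<bar> \<le> y b"
      if "q \<in> A \<times> A" "prod_le le (a1, a2) q" for q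
    proof -
      have "prod_le (\<le>) (x a1, x a2) (x (fst q), x (snd q))"
        using that a mono unfolding prod_le_def monotone_on_def by auto
      then show ?thesis using * that(1) by auto
    qed
    then show "\<exists>p\<in>A \<times> A. \<forall>q\<in>A \<times> A. prod_le le p q \<longrightarrow>
        \<bar>f (x (fst q), x (snd q)) - l\<bar> \<le> y b"
      using a by blast
  qed
qed

lemma mlo_cauchy_image:
  assumes "increasing_net A le x" "mlo_cauchy (x ` A) (\<le>) T"
  shows "mlo_cauchy A le (\<lambda>a. T (x a))"
proof -
  have "o_converges (A \<times> A) (prod_le le) (\<lambda>p. u * \<bar>T (x (fst p)) - T (x (snd p))\<bar>) 0" if "0 \<le> u" for u
  proof -
    have "o_converges (x ` A \<times> x ` A) (prod_le (\<le>)) (\<lambda>p. u * \<bar>T (fst p) - T (snd p)\<bar>) 0"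
      using assms(2) that unfolding mlo_cauchy_def mlo_converges_def by (simp add: case_prod_beta)
    from o_converges_pair_image[OF _ this, of le] assms(1) show ?thesis
      unfolding increasing_net_def by simp
  qed
  then show ?thesis
    unfolding mlo_cauchy_def mlo_converges_def by (simp add: case_prod_beta)
qed

lemma mro_cauchy_image:
  assumes "increasing_net A le x" "mro_cauchy (x ` A) (\<le>) T"
  shows "mro_cauchy A le (\<lambda>a. T (x a))"
proof -
  have "o_converges (A \<times> A) (prod_le le) (\<lambda>p. \<bar>T (x (fst p)) - T (x (snd p))\<bar> * u) 0" if "0 \<le> u" for u
  proof -
    have "o_converges (x ` A \<times> x ` A) (prod_le (\<le>)) (\<lambda>p. \<bar>T (fst p) - T (snd p)\<bar> * u) 0"
      using assms(2) that unfolding mro_cauchy_def mro_converges_def by (simp add: case_prod_beta)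
    from o_converges_pair_image[OF _ this, of le] assms(1) show ?thesis
      unfolding increasing_net_def by simp
  qed
  then show ?thesis
    unfolding mro_cauchy_def mro_converges_def by (simp add: case_prod_beta)
qed

lemma mo_cauchy_iff: "mo_cauchy A le y \<longleftrightarrow> mlo_cauchy A le y \<and> mro_cauchy A le y"
  by (simp add: mo_cauchy_def mlo_cauchy_def mro_cauchy_def mo_converges_def)

lemma quasi_mlo_levi_any_index:
  fixes A :: "'i set"
  assumes "quasi_mlo_levi T" and inc: "increasing_net A le x"
    and "\<forall>a\<in>A. 0 \<le> x a" "mlo_bounded (x ` A)"
  shows "mlo_cauchy A le (\<lambda>a. T (x a))"
proof (rule mlo_cauchy_image[OF inc])
  show "mlo_cauchy (x ` A) (\<le>) T"
    using assms(1)[unfolded quasi_mlo_levi_def, rule_format, of "x ` A" "(\<le>)" "\<lambda>v. v"]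
      assms(3,4) increasing_net_image[OF inc] by auto
qed

lemma quasi_mro_levi_any_index:
  fixes A :: "'i set"
  assumes "quasi_mro_levi T" and inc: "increasing_net A le x"
    and "\<forall>a\<in>A. 0 \<le> x a" "mro_bounded (x ` A)"
  shows "mro_cauchy A le (\<lambda>a. T (x a))"
proof (rule mro_cauchy_image[OF inc])
  show "mro_cauchy (x ` A) (\<le>) T"
    using assms(1)[unfolded quasi_mro_levi_def, rule_format, of "x ` A" "(\<le>)" "\<lambda>v. v"]
      assms(3,4) increasing_net_image[OF inc] by auto
qed

lemma quasi_mo_levi_any_index:
  fixes A :: "'i set"
  assumes "quasi_mo_levi T" and inc: "increasing_net A le x"
    and "\<forall>a\<in>A. 0 \<le> x a" "mo_bounded (x ` A)"
  shows "mo_cauchy A le (\<lambda>a. T (x a))"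
proof -
  have "mo_cauchy (x ` A) (\<le>) T"
    using assms(1)[unfolded quasi_mo_levi_def, rule_format, of "x ` A" "(\<le>)" "\<lambda>v. v"]
      assms(3,4) increasing_net_image[OF inc] by auto
  then show ?thesis
    using mlo_cauchy_image[OF inc] mro_cauchy_image[OF inc] by (auto simp: mo_cauchy_iff)
qed

definition positive_map :: "('e::riesz_algebra \<Rightarrow> 'f::riesz_algebra) \<Rightarrow> bool" where
  "positive_map T \<longleftrightarrow> (\<forall>x\<ge>0. 0 \<le> T x)"

(* The operator order; it is not the pointwise order on functions. *)
definition operator_le ::
  "('e::riesz_algebra \<Rightarrow> 'f::riesz_algebra) \<Rightarrow> ('e \<Rightarrow> 'f) \<Rightarrow> bool" where
  "operator_le R Q \<longleftrightarrow> positive_map (\<lambda>x. Q x - R x)"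

end

theory Submission
  imports Defs
begin

text \<open>
  Let \<open>x\<close> be an increasing net and \<open>0 \<le> S \<le> T\<close>. For \<open>a \<le> b\<close> the vector \<open>x b - x a\<close> is positive, so
  \<open>0 \<le> S (x b) - S (x a) \<le> T (x b) - T (x a)\<close>: the increments of \<open>S \<circ> x\<close> are controlled by those of
  \<open>T \<circ> x\<close>. Cauchyness, however, also concerns pairs of incomparable indices. If \<open>a\<close> and \<open>b\<close> both lie
  above \<open>c\<close> and \<open>d\<close> lies above both of them, monotonicity of \<open>S \<circ> x\<close> places \<open>S (x a)\<close> and
  \<open>S (x b)\<close> in the interval from \<open>S (x c)\<close> to \<open>S (x d)\<close>, and hence
  \<open>\<bar>S (x a) - S (x b)\<bar> \<le> S (x d) - S (x c) \<le> T (x d) - T (x c) = \<bar>T (x d) - T (x c)\<bar>\<close>.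
  A net that dominates the differences of \<open>T \<circ> x\<close> therefore dominates those of \<open>S \<circ> x\<close> as well. Left and
  right multiplication by a positive element preserve these inequalities, so one argument settles all three kinds
  of convergence. The boundedness of \<open>x\<close> is a condition in the domain alone, shared by \<open>S\<close> and \<open>T\<close>.
\<close>

text \<open>
  The map \<open>\<phi>\<close> stands for multiplication by a positive element from the left or from the right.
  The difference for an arbitrary pair of indices is bounded by the increment of \<open>s\<close> from a lower to an upper bound
  of the pair, so the dominating net for \<open>t\<close> works for \<open>s\<close> unchanged.
\<close>
lemma o_cauchy_dominated_increments:
  fixes s t :: "'i \<Rightarrow> 'f::lattice_ab_group_add_abs" and \<phi> :: "'f \<Rightarrow> 'f"
  assumes dir: "directed_set A le"
    and s_incr: "\<And>a b. \<lbrakk>a \<in> A; b \<in> A; le a b\<rbrakk> \<Longrightarrow> s a \<le> s b"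
    and s_le_t: "\<And>a b. \<lbrakk>a \<in> A; b \<in> A; le a b\<rbrakk> \<Longrightarrow> s b - s a \<le> t b - t a"
    and \<phi>: "mono_on {0..} \<phi>" "\<phi> 0 = 0"
    and conv: "o_converges (A \<times> A) (prod_le le) (\<lambda>(a, b). \<phi> \<bar>t a - t b\<bar>) 0"
  shows "o_converges (A \<times> A) (prod_le le) (\<lambda>(a, b). \<phi> \<bar>s a - s b\<bar>) 0"
proof -
  have upper: "\<exists>c\<in>A. le a c \<and> le b c" if "a \<in> A" "b \<in> A" for a b
    using dir that unfolding directed_set_def by blast
  have le_trans: "le a c" if "le a b" "le b c" "a \<in> A" "b \<in> A" "c \<in> A" for a b c
    using dir that unfolding directed_set_def by (meson transp_onD)
  have \<phi>_mono: "\<phi> v \<le> \<phi> w" if "0 \<le> v" "v \<le> w" for v w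
    using \<phi>(1) that by (auto elim: mono_onD)
  have \<phi>_nonneg: "0 \<le> \<phi> v" if "0 \<le> v" for v
    using \<phi>_mono[of 0 v] that \<phi>(2) by simp
  obtain B :: "'f set" and leB and y :: "'f \<Rightarrow> 'f" where y: "decreasing_to_zero B leB y"
    and dom: "\<forall>\<beta>\<in>B. \<exists>p\<in>A \<times> A. \<forall>q\<in>A \<times> A. prod_le le p q \<longrightarrow>
                \<bar>(case q of (a, b) \<Rightarrow> \<phi> \<bar>t a - t b\<bar>) - 0\<bar> \<le> y \<beta>"
    using conv unfolding o_converges_def by blast
  show ?thesis
  proof (rule o_convergesI[OF y])
    fix \<beta> assume "\<beta> \<in> B"
    then obtain a1 a2 where a12: "a1 \<in> A" "a2 \<in> A"
      and t_small: "\<And>a b. \<lbrakk>a \<in> A; b \<in> A; le a1 a; le a2 b\<rbrakk> \<Longrightarrow> \<phi> \<bar>t a - t b\<bar> \<le> y \<beta>"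
      using dom \<phi>_nonneg unfolding prod_le_def by fastforce
    \<comment> \<open>The index \<open>c\<close> has to serve in both coordinates, hence the common upper bound.\<close>
    obtain c where c: "c \<in> A" "le a1 c" "le a2 c"
      using upper a12 by blast
    have "\<phi> \<bar>s a - s b\<bar> \<le> y \<beta>" if ab: "a \<in> A" "b \<in> A" "le c a" "le c b" for a b
    proof -
      obtain d where d: "d \<in> A" "le a d" "le b d"
        using upper ab by blast
      have cd: "le c d"
        using le_trans[OF ab(3) d(2)] ab(1) c(1) d(1) by blast
      have "s a - s b \<le> s d - s c" "s b - s a \<le> s d - s c"
        using s_incr ab c(1) d by (simp_all add: diff_mono)
      then have "\<bar>s a - s b\<bar> \<le> s d - s c"
        by (simp add: abs_le_iff)
      also have "\<dots> \<le> t d - t c"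
        using s_le_t c(1) d(1) cd by blast
      also have "\<dots> \<le> \<bar>t d - t c\<bar>"
        by (rule abs_ge_self)
      finally have "\<phi> \<bar>s a - s b\<bar> \<le> \<phi> \<bar>t d - t c\<bar>"
        by (simp add: \<phi>_mono)
      also have "\<dots> \<le> y \<beta>"
        using t_small c d(1) le_trans[OF c(2) cd] a12 by blast
      finally show ?thesis .
    qed
    then show "\<exists>p\<in>A \<times> A. \<forall>q\<in>A \<times> A. prod_le le p q \<longrightarrow>
        \<bar>(case q of (a, b) \<Rightarrow> \<phi> \<bar>s a - s b\<bar>) - 0\<bar> \<le> y \<beta>"
      using c(1) \<phi>_nonneg by (intro bexI[of _ "(c, c)"]) (auto simp: prod_le_def)
  qed
qed

text \<open>The increments of \<open>S \<circ> x\<close> are values of \<open>S\<close> at positive vectors, which is where \<open>0 \<le> S \<le> T\<close> gives information.\<close>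
lemma operator_le_increments:
  fixes S T :: "'e::riesz_algebra \<Rightarrow> 'f::riesz_algebra"
  assumes "linear T" "linear S" "operator_le (\<lambda>_. 0) S" "operator_le S T" "v \<le> w"
  shows "S v \<le> S w" "S w - S v \<le> T w - T v"
proof -
  have "0 \<le> S (w - v)" "S (w - v) \<le> T (w - v)"
    using assms(3-5) by (simp_all add: operator_le_def positive_map_def)
  then show "S v \<le> S w" "S w - S v \<le> T w - T v"
    using assms(1,2) by (simp_all add: linear_diff)
qed

lemma mlo_cauchy_dominated_operator:
  fixes S T :: "'e::riesz_algebra \<Rightarrow> 'f::riesz_algebra"
  assumes ops: "linear T" "linear S" "operator_le (\<lambda>_. 0) S" "operator_le S T"
    and inc: "increasing_net A le x"
    and cauchy: "mlo_cauchy A le (\<lambda>a. T (x a))"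
  shows "mlo_cauchy A le (\<lambda>a. S (x a))"
proof -
  have "o_converges (A \<times> A) (prod_le le) (\<lambda>(a, b). u * \<bar>S (x a) - S (x b)\<bar>) 0" if "0 \<le> u" for u
  proof (rule o_cauchy_dominated_increments[where t = "\<lambda>a. T (x a)" and \<phi> = "\<lambda>v. u * v"])
    show "mono_on {0..} (\<lambda>v. u * v)"
      using that by (auto intro: mono_onI mult_left_mono)
    show "o_converges (A \<times> A) (prod_le le) (\<lambda>(a, b). u * \<bar>T (x a) - T (x b)\<bar>) 0"
      using cauchy that unfolding mlo_cauchy_def mlo_converges_def by (simp add: case_prod_unfold)
  qed (use inc in \<open>auto simp: increasing_net_def dest: monotone_onD intro!: operator_le_increments[OF ops]\<close>)
  then show ?thesis
    unfolding mlo_cauchy_def mlo_converges_def by (simp add: case_prod_unfold)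
qed

lemma mro_cauchy_dominated_operator:
  fixes S T :: "'e::riesz_algebra \<Rightarrow> 'f::riesz_algebra"
  assumes ops: "linear T" "linear S" "operator_le (\<lambda>_. 0) S" "operator_le S T"
    and inc: "increasing_net A le x"
    and cauchy: "mro_cauchy A le (\<lambda>a. T (x a))"
  shows "mro_cauchy A le (\<lambda>a. S (x a))"
proof -
  have "o_converges (A \<times> A) (prod_le le) (\<lambda>(a, b). \<bar>S (x a) - S (x b)\<bar> * u) 0" if "0 \<le> u" for u
  proof (rule o_cauchy_dominated_increments[where t = "\<lambda>a. T (x a)" and \<phi> = "\<lambda>v. v * u"])
    show "mono_on {0..} (\<lambda>v. v * u)"
      using that by (auto intro: mono_onI mult_right_mono)
    show "o_converges (A \<times> A) (prod_le le) (\<lambda>(a, b). \<bar>T (x a) - T (x b)\<bar> * u) 0"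
      using cauchy that unfolding mro_cauchy_def mro_converges_def by (simp add: case_prod_unfold)
  qed (use inc in \<open>auto simp: increasing_net_def dest: monotone_onD intro!: operator_le_increments[OF ops]\<close>)
  then show ?thesis
    unfolding mro_cauchy_def mro_converges_def by (simp add: case_prod_unfold)
qed

theorem theorem3p6:
  fixes T :: "'e::riesz_algebra \<Rightarrow> 'f::riesz_algebra"
  assumes "linear T" and "positive_map T"
  shows "(quasi_mlo_levi T \<longrightarrow>
            (\<forall>S. linear S \<and> operator_le (\<lambda>_. 0) S \<and> operator_le S T \<longrightarrow> quasi_mlo_levi S)) \<and>
         (quasi_mro_levi T \<longrightarrow>
            (\<forall>S. linear S \<and> operator_le (\<lambda>_. 0) S \<and> operator_le S T \<longrightarrow> quasi_mro_levi S)) \<and>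
         (quasi_mo_levi T \<longrightarrow>
            (\<forall>S. linear S \<and> operator_le (\<lambda>_. 0) S \<and> operator_le S T \<longrightarrow> quasi_mo_levi S))"
proof (intro conjI impI allI; elim conjE)
  fix S :: "'e \<Rightarrow> 'f"
  assume S: "linear S" "operator_le (\<lambda>_. 0) S" "operator_le S T"
  note mlo = mlo_cauchy_dominated_operator[OF assms(1) S]
  note mro = mro_cauchy_dominated_operator[OF assms(1) S]
  show "quasi_mlo_levi S" if "quasi_mlo_levi T"
    using that mlo unfolding quasi_mlo_levi_def by blast
  show "quasi_mro_levi S" if "quasi_mro_levi T"
    using that mro unfolding quasi_mro_levi_def by blast
  show "quasi_mo_levi S" if "quasi_mo_levi T"
    using that mlo mro unfolding quasi_mo_levi_def mo_cauchy_iff by blast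
qed

end
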